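(* Let $d$ be a positive integer, let $G=(V,E)$ be a finite connected graph and let $f_E:E\to\mathbb{Z}_d$ be an e-labeling such that $(G,f_E)$ is additive. Let $N(G,f_E)$ be the number of valid v-labelings of $(G,f_E)$. If $G$ has no simple cycle of odd length, then $N(G,f_E)=d$. If $G$ has at least one simple cycle of odd length, then $N(G,f_E)=1$ when $d$ is odd and $N(G,f_E)=2$ when $d$ is even.
   Context: $\mathbb{Z}_d$ denotes the integers modulo $d$. An e-labeling is a map $f_E:E\to\mathbb{Z}_d$ and a v-labeling is a map $f_V:V\to\mathbb{Z}_d$. A v-labeling $f_V$ is a valid v-labeling of $(G,f_E)$ if $f_E((v,v'))\equiv f_V(v)+f_V(v')\pmod d$ for every edge $(v,v')\in E$; $(G,f_E)$ is additive if a valid v-labeling exists. A simple cycle is a cycle with no repeated vertices. *)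

theory Defs
  imports "HOL-Library.FuncSet" "HOL-Number_Theory.Cong"
begin

text \<open>An edge is an unordered pair \<open>{u, v}\<close> of vertices. The case \<open>u = v\<close> (a loop) is permitted;
  simple graphs are the instance without loops.\<close>

definition finite_graph :: "'a set \<Rightarrow> 'a set set \<Rightarrow> bool" where
  "finite_graph V E \<longleftrightarrow> finite V \<and> (\<forall>e\<in>E. \<exists>u\<in>V. \<exists>v\<in>V. e = {u, v})"

definition adjacent :: "'a set set \<Rightarrow> 'a \<Rightarrow> 'a \<Rightarrow> bool" where
  "adjacent E u v \<longleftrightarrow> {u, v} \<in> E"

text \<open>A connected graph has at least one vertex.\<close>

definition connected_graph :: "'a set \<Rightarrow> 'a set set \<Rightarrow> bool" where
  "connected_graph V E \<longleftrightarrow> V \<noteq> {} \<and> (\<forall>u\<in>V. \<forall>v\<in>V. (adjacent E)\<^sup>*\<^sup>* u v)"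

text \<open>A simple cycle is given by its list of vertices \<open>[v\<^sub>0, \<dots>, v\<^sub>k\<^sub>-\<^sub>1]\<close>, without repeating \<open>v\<^sub>0\<close> at the
  end, so its length as a cycle is the length of the list. Length 2 is excluded because it would
  use one edge twice; length 1 is a loop.\<close>

definition simple_cycle :: "'a set set \<Rightarrow> 'a list \<Rightarrow> bool" where
  "simple_cycle E p \<longleftrightarrow> p \<noteq> [] \<and> length p \<noteq> 2 \<and> distinct p \<and>
     (\<forall>i<length p. adjacent E (p ! i) (p ! (Suc i mod length p)))"

definition has_odd_simple_cycle :: "'a set set \<Rightarrow> bool" where
  "has_odd_simple_cycle E \<longleftrightarrow> (\<exists>p. simple_cycle E p \<and> odd (length p))"

text \<open>The integers modulo \<open>d\<close> are represented by the residues \<open>{..<d}\<close>. Labelings are extensional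
  functions, so that two labelings are equal iff they agree on \<open>X\<close>.\<close>

definition labelings :: "nat \<Rightarrow> 'b set \<Rightarrow> ('b \<Rightarrow> nat) set" where
  "labelings d X = X \<rightarrow>\<^sub>E {..<d}"

definition valid_v_labelings ::
  "nat \<Rightarrow> 'a set \<Rightarrow> 'a set set \<Rightarrow> ('a set \<Rightarrow> nat) \<Rightarrow> ('a \<Rightarrow> nat) set" where
  "valid_v_labelings d V E fE =
     {fV \<in> labelings d V. \<forall>u v. {u, v} \<in> E \<longrightarrow> [fE {u, v} = fV u + fV v] (mod d)}"

definition additive_labeling :: "nat \<Rightarrow> 'a set \<Rightarrow> 'a set set \<Rightarrow> ('a set \<Rightarrow> nat) \<Rightarrow> bool" where
  "additive_labeling d V E fE \<longleftrightarrow> (\<exists>fV. fV \<in> valid_v_labelings d V E fE)"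

definition num_valid :: "nat \<Rightarrow> 'a set \<Rightarrow> 'a set set \<Rightarrow> ('a set \<Rightarrow> nat) \<Rightarrow> nat" where
  "num_valid d V E fE = card (valid_v_labelings d V E fE)"

end

theory Submission
  imports Defs
begin

text \<open>The difference \<open>g\<close> of two valid labelings satisfies \<open>g u + g v = 0\<close> along every edge, so on a
  connected graph a valid labeling is determined by its value at one vertex \<open>r\<close>, and it remains to
  see which values occur. If there is no odd simple cycle, then there is no odd closed walk, because
  a shortest one would be simple; the graph is then 2-colourable, and adding \<open>t\<close> on one colour class
  and subtracting it on the other realises all \<open>d\<close> values. An odd cycle forces \<open>2 * g = 0\<close>, and
  conversely every constant \<open>g\<close> with \<open>2 * g = 0\<close> may be added, so the possible values at \<open>r\<close> are a
  coset of the 2-torsion of the integers modulo \<open>d\<close>.\<close>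

lemma adjacent_sym: "adjacent E u v \<Longrightarrow> adjacent E v u"
  by (simp add: adjacent_def insert_commute)

lemma finite_graph_adjacentD:
  assumes "finite_graph V E" "adjacent E u v"
  shows "u \<in> V" "v \<in> V"
  using assms unfolding finite_graph_def adjacent_def by (force simp: doubleton_eq_iff)+

subsection \<open>Odd closed walks\<close>

text \<open>Same list format as \<open>simple_cycle\<close>, but with repetitions allowed, so that
  walks can be cut and spliced.\<close>

definition closed_walk :: "'a set set \<Rightarrow> 'a list \<Rightarrow> bool" where
  "closed_walk E p \<longleftrightarrow> p \<noteq> [] \<and> successively (adjacent E) (p @ [hd p])"

lemma closed_walk_nth:
  "closed_walk E p \<longleftrightarrow>
     p \<noteq> [] \<and> (\<forall>i<length p. adjacent E (p ! i) (p ! (Suc i mod length p)))"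
proof (cases "p = []")
  case False
  have "(p @ [hd p]) ! Suc i = p ! (Suc i mod length p)" if "i < length p" for i
    using that False by (cases "Suc i = length p") (auto simp: nth_append hd_conv_nth)
  then show ?thesis
    using False by (auto simp: closed_walk_def successively_conv_nth nth_append)
qed (simp add: closed_walk_def)

text \<open>Strong induction on the length: a repeated vertex cuts the walk into two shorter closed
  walks whose lengths sum to an odd number, so one of them is odd.\<close>

lemma odd_closed_walk_imp_odd_simple_cycle:
  assumes "closed_walk E p" "odd (length p)"
  shows "has_odd_simple_cycle E"
  using assms
proof (induction "length p" arbitrary: p rule: less_induct)
  case less
  show ?case
  proof (cases "distinct p")
    case True
    then have "simple_cycle E p"
      using less.prems unfolding simple_cycle_def closed_walk_nth by auto
    then show ?thesis
      using less.prems(2) unfolding has_odd_simple_cycle_def by blast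
  next
    case False
    then obtain xs ys zs y where p: "p = xs @ [y] @ ys @ [y] @ zs"
      using not_distinct_decomp by blast
    \<comment> \<open>Bracketed so that each of the two visits to \<open>y\<close> ends a block;
      cutting there separates the inner loop from the rest.\<close>
    have "successively (adjacent E) ((xs @ [y]) @ (ys @ [y]) @ zs @ [hd (xs @ [y])])"
      using less.prems(1) unfolding p closed_walk_def by (cases xs) auto
    then have split: "successively (adjacent E) (xs @ [y])"
        "successively (adjacent E) (y # ys @ [y])"
        "successively (adjacent E) (y # zs @ [hd (xs @ [y])])"
      by (auto simp: successively_append_iff successively_Cons hd_append)
    have inner: "closed_walk E (y # ys)"
      using split(2) unfolding closed_walk_def by simp
    have "hd (xs @ y # zs) = hd (xs @ [y])"
      by (cases xs) auto
    with split have outer: "closed_walk E (xs @ y # zs)"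
      unfolding closed_walk_def by (simp add: successively_append_iff)
    have "odd (length (y # ys)) \<or> odd (length (xs @ y # zs))"
      using less.prems(2) unfolding p by auto
    then show ?thesis
    proof
      assume "odd (length (y # ys))"
      then show ?thesis by (rule less.hyps[OF _ inner, rotated]) (simp add: p)
    next
      assume "odd (length (xs @ y # zs))"
      then show ?thesis by (rule less.hyps[OF _ outer, rotated]) (simp add: p)
    qed
  qed
qed

lemma odd_relpowp_imp_odd_simple_cycle:
  assumes "(adjacent E ^^ n) x x" "odd n"
  shows "has_odd_simple_cycle E"
proof -
  obtain f where f: "f 0 = x" "f n = x" "\<forall>i<n. adjacent E (f i) (f (Suc i))"
    using assms(1) unfolding relpowp_fun_conv by blast
  have "closed_walk E (map f [0..<n])"
    unfolding closed_walk_nth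
  proof (intro conjI allI impI)
    show "map f [0..<n] \<noteq> []"
      using assms(2) by (cases n) auto
    fix i assume i: "i < length (map f [0..<n])"
    then have "f (Suc i mod n) = f (Suc i)"
      \<comment> \<open>At the last index the list wraps to \<open>f 0\<close>, which equals
        \<open>f n\<close>.\<close>
      using f by (cases "Suc i = n") auto
    then show "adjacent E (map f [0..<n] ! i)
        (map f [0..<n] ! (Suc i mod length (map f [0..<n])))"
      using i f by simp
  qed
  then show ?thesis
    using odd_closed_walk_imp_odd_simple_cycle assms(2) by fastforce
qed

lemma relpowp_adjacent_sym:
  "(adjacent E ^^ n) x y \<Longrightarrow> (adjacent E ^^ n) y x"
proof (induction n arbitrary: y)
  case (Suc n)
  from Suc.prems obtain z where "(adjacent E ^^ n) x z" "adjacent E z y"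
    by (rule relpowp_Suc_E)
  then show ?case
    using relpowp_Suc_I2[OF adjacent_sym Suc.IH] by fast
qed simp

text \<open>The colours are the integers 1 and -1, so that multiples of \<open>s\<close> can serve
  as shifts of a labeling.\<close>

lemma ex_two_colouring:
  assumes conn: "connected_graph V E" and fin: "finite_graph V E"
    and "\<not> has_odd_simple_cycle E"
  obtains s :: "'a \<Rightarrow> int"
  where "\<And>u v. adjacent E u v \<Longrightarrow> s u + s v = 0" "\<And>v. \<bar>s v\<bar> = 1"
proof -
  obtain r where r: "r \<in> V"
    using conn unfolding connected_graph_def by blast
  define ev where "ev v \<longleftrightarrow> (\<exists>n. even n \<and> (adjacent E ^^ n) r v)" for v
  have bip: "ev u \<longleftrightarrow> \<not> ev v" if uv: "adjacent E u v" for u v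
  proof -
    \<comment> \<open>Two walks from \<open>r\<close> of equal length parity, joined by the edge
      from \<open>u\<close> to \<open>v\<close>, would close up to an odd walk at
      \<open>r\<close>.\<close>
    have no: False if m: "(adjacent E ^^ m) r u" and n: "(adjacent E ^^ n) r v"
      and "even (m + n)" for m n
    proof -
      have "(adjacent E ^^ (Suc m + n)) r r"
        unfolding relpowp_add
        using relpowp_Suc_I[OF m uv] relpowp_adjacent_sym[OF n] by blast
      then show False
        using odd_relpowp_imp_odd_simple_cycle[of "Suc m + n" E r] assms(3) that(3) by simp
    qed
    have "\<exists>n. (adjacent E ^^ n) r w" if "w \<in> V" for w
      using conn r that unfolding connected_graph_def by (meson rtranclp_imp_relpowp)
    then obtain m n where "(adjacent E ^^ m) r u" "(adjacent E ^^ n) r v"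
      using finite_graph_adjacentD[OF fin uv] by blast
    then show ?thesis
      using no unfolding ev_def by (metis even_add)
  qed
  show ?thesis
    by (rule that[of "\<lambda>v. if ev v then 1 else -1"]) (auto dest: bip)
qed

subsection \<open>The difference of two valid labelings\<close>

text \<open>Passing to integers makes differences of labelings available.\<close>

lemma valid_v_labelings_iff:
  "f \<in> valid_v_labelings d V E fE \<longleftrightarrow> f \<in> V \<rightarrow>\<^sub>E {..<d} \<and>
     (\<forall>u v. adjacent E u v \<longrightarrow> [int (fE {u, v}) = int (f u) + int (f v)] (mod int d))"
  unfolding valid_v_labelings_def labelings_def adjacent_def
  by (simp flip: cong_int_iff)

lemma valid_diff_dvd:
  assumes "f \<in> valid_v_labelings d V E fE" "f' \<in> valid_v_labelings d V E fE" "adjacent E u v"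
  shows "int d dvd (int (f u) - int (f' u)) + (int (f v) - int (f' v))"
proof -
  have "[int (f u) + int (f v) = int (f' u) + int (f' v)] (mod int d)"
    using assms unfolding valid_v_labelings_iff by (meson cong_sym cong_trans)
  then show ?thesis
    by (simp add: cong_iff_dvd_diff algebra_simps)
qed

text \<open>Modulo \<open>k\<close>, each edge only flips the sign of \<open>g\<close>. The factor
  \<open>c\<close> is 1 for uniqueness and 2 for the torsion condition.\<close>

lemma dvd_alternating_propagate:
  fixes g :: "'a \<Rightarrow> int"
  assumes "(adjacent E)\<^sup>*\<^sup>* x y" and "\<And>u v. adjacent E u v \<Longrightarrow> k dvd g u + g v"
    and "k dvd c * g x"
  shows "k dvd c * g y"
  using assms(1)
proof (induction rule: rtranclp_induct)
  case base
  show ?case by fact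
next
  case (step y z)
  have "k dvd c * (g y + g z) - c * g y"
    using assms(2)[OF step(2)] step.IH by (rule dvd_diff[OF dvd_mult])
  then show ?case by (simp add: algebra_simps)
qed

lemma dvd_alternating_odd_cycle:
  fixes g :: "'a \<Rightarrow> int"
  assumes g: "\<And>u v. adjacent E u v \<Longrightarrow> k dvd g u + g v"
    and p: "simple_cycle E p" "odd (length p)"
  shows "k dvd 2 * g (hd p)"
proof -
  have adj: "adjacent E (p ! i) (p ! (Suc i mod length p))" if "i < length p" for i
    using p that unfolding simple_cycle_def by blast
  have ne: "p \<noteq> []"
    using p unfolding simple_cycle_def by blast
  have alt: "i < length p \<Longrightarrow> k dvd g (p ! i) - (-1) ^ i * g (p ! 0)" for i
  proof (induction i)
    case (Suc i)
    then have "k dvd (g (p ! i) + g (p ! Suc i)) - (g (p ! i) - (-1) ^ i * g (p ! 0))"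
      using g[OF adj[of i]] by (intro dvd_diff[of k "g (p ! i) + g (p ! Suc i)"]) auto
    then show ?case by (simp add: algebra_simps)
  qed simp
  define n where "n = length p - 1"
  have n: "length p = Suc n" "even n"
    using p(2) ne unfolding n_def by (cases p; auto)+
  \<comment> \<open>Since \<open>n\<close> is even, \<open>g\<close> agrees modulo \<open>k\<close>
    at both ends of the closing edge. A loop is the case \<open>n = 0\<close>.\<close>
  have "k dvd (g (p ! n) + g (p ! 0)) - (g (p ! n) - g (p ! 0))"
    using g[OF adj[of n]] alt[of n] n
    by (intro dvd_diff[of k "g (p ! n) + g (p ! 0)"]) auto
  then show ?thesis
    using ne by (simp add: hd_conv_nth)
qed

lemma residue_eq_if_dvd_diff:
  assumes "a < d" "b < d" "int d dvd int a - int b"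
  shows "a = b"
proof -
  have "[int a = int b] (mod int d)"
    using assms(3) by (simp add: cong_iff_dvd_diff)
  then show ?thesis
    using assms(1,2) cong_less_modulus_unique_nat by (simp add: cong_int_iff)
qed

text \<open>Reduces counting labelings to counting their values at \<open>r\<close>: a difference
  that vanishes at \<open>r\<close> vanishes along every walk.\<close>

lemma inj_on_valid_eval:
  assumes "connected_graph V E" "r \<in> V"
  shows "inj_on (\<lambda>f. f r) (valid_v_labelings d V E fE)"
proof (rule inj_onI)
  fix f f' assume f: "f \<in> valid_v_labelings d V E fE" and f': "f' \<in> valid_v_labelings d V E fE"
    and eq: "f r = f' r"
  have PiE: "f \<in> V \<rightarrow>\<^sub>E {..<d}" "f' \<in> V \<rightarrow>\<^sub>E {..<d}"
    using f f' unfolding valid_v_labelings_iff by auto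
  show "f = f'"
  proof (rule PiE_ext[OF PiE])
    fix v assume v: "v \<in> V"
    then have "(adjacent E)\<^sup>*\<^sup>* r v"
      using assms unfolding connected_graph_def by blast
    then have "int d dvd 1 * (int (f v) - int (f' v))"
      by (rule dvd_alternating_propagate) (use valid_diff_dvd[OF f f'] eq in auto)
    then have "int d dvd int (f v) - int (f' v)"
      by simp
    then show "f v = f' v"
      using PiE v by (intro residue_eq_if_dvd_diff) auto
  qed
qed

lemma valid_shift:
  fixes s :: "'a \<Rightarrow> int"
  assumes "d > 0" "finite_graph V E" and f: "f \<in> valid_v_labelings d V E fE"
    and s: "\<And>u v. adjacent E u v \<Longrightarrow> int d dvd s u + s v"
  shows "(\<lambda>v\<in>V. nat ((int (f v) + s v) mod int d)) \<in> valid_v_labelings d V E fE"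
    (is "?f \<in> _")
  unfolding valid_v_labelings_iff
proof (intro conjI allI impI)
  show "?f \<in> V \<rightarrow>\<^sub>E {..<d}"
    using assms(1) by (auto simp: nat_less_iff)
next
  fix u v assume uv: "adjacent E u v"
  have "int (?f w) = (int (f w) + s w) mod int d" if "w \<in> V" for w
    using that assms(1) by simp
  then have "[int (?f u) + int (?f v) = (int (f u) + s u) + (int (f v) + s v)] (mod int d)"
    using finite_graph_adjacentD[OF assms(2) uv] by (simp only: cong_def mod_add_eq)
  then have "[int (?f u) + int (?f v) = (int (f u) + int (f v)) + (s u + s v)] (mod int d)"
    by (simp only: ac_simps)
  moreover have "[int (f u) + int (f v) + (s u + s v) = int (fE {u, v}) + 0] (mod int d)"
    using f uv s[OF uv] unfolding valid_v_labelings_iff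
    by (intro cong_add) (auto simp: cong_sym cong_0_iff)
  ultimately show "[int (fE {u, v}) = int (?f u) + int (?f v)] (mod int d)"
    by (simp add: cong_def)
qed

lemma valid_shift_to:
  fixes s :: "'a \<Rightarrow> int"
  assumes "d > 0" "finite_graph V E" "f \<in> valid_v_labelings d V E fE" "r \<in> V" "t < d"
    and "\<And>u v. adjacent E u v \<Longrightarrow> int d dvd s u + s v" and "s r = int t - int (f r)"
  shows "t \<in> (\<lambda>f. f r) ` valid_v_labelings d V E fE"
  by (rule image_eqI[OF _ valid_shift[where s = s]]) (use assms in auto)

subsection \<open>Counting\<close>

text \<open>For odd \<open>d\<close>, 2 is invertible; for \<open>d = 2 * m\<close> the condition
  says that \<open>t\<close> and \<open>a\<close> agree modulo \<open>m\<close>.\<close>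

lemma card_double_cong:
  assumes "a < d"
  shows "card {t. t < d \<and> int d dvd 2 * (int t - int a)} = (if odd d then 1 else 2)"
proof (cases "odd d")
  case True
  then have "coprime (int d) 2"
    by simp
  then have "t = a" if "t < d" "int d dvd 2 * (int t - int a)" for t
    using residue_eq_if_dvd_diff[OF that(1) assms] that(2) coprime_dvd_mult_right_iff by blast
  moreover have "int d dvd 2 * (int a - int a)"
    by simp
  ultimately have "{t. t < d \<and> int d dvd 2 * (int t - int a)} = {a}"
    using assms by blast
  with True show ?thesis by simp
next
  case False
  then obtain m where d: "d = 2 * m" by blast
  \<comment> \<open>This is \<open>a + m\<close> reduced modulo \<open>d\<close>.\<close>
  define b where "b = (if a < m then a + m else a - m)"
  have "t = a \<or> t = b" if "t < d" "int d dvd 2 * (int t - int a)" for t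
  proof -
    have "int m dvd int t - int a"
      using that(2) unfolding d of_nat_mult of_nat_numeral dvd_mult_cancel_left by simp
    then obtain q where q: "int t - int a = int m * q" by blast
    have "- 2 < q \<and> q < 2"
    proof -
      have "\<bar>int m * q\<bar> < int m * 2"
        using that(1) assms unfolding q[symmetric] d by linarith
      then have "int m * \<bar>q\<bar> < int m * 2"
        by (simp add: abs_mult)
      then have "\<bar>q\<bar> < 2"
        by (rule mult_left_less_imp_less) simp
      then show ?thesis by linarith
    qed
    then have "q = -1 \<or> q = 0 \<or> q = 1" by linarith
    then show ?thesis
      using q that(1) assms unfolding b_def d by auto
  qed
  moreover have "b < d" "a \<noteq> b" "int d dvd 2 * (int b - int a)"
    using assms unfolding b_def d by auto
  ultimately have "{t. t < d \<and> int d dvd 2 * (int t - int a)} = {a, b}"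
    using assms by auto
  with False \<open>a \<noteq> b\<close> show ?thesis by simp
qed

theorem theorem2:
  fixes d :: nat and V :: "'a set" and E :: "'a set set" and fE :: "'a set \<Rightarrow> nat"
  assumes "d > 0"
    and "finite_graph V E"
    and "connected_graph V E"
    and "fE \<in> labelings d E"
    and "additive_labeling d V E fE"
  shows "(\<not> has_odd_simple_cycle E \<longrightarrow> num_valid d V E fE = d) \<and>
         (has_odd_simple_cycle E \<longrightarrow>
            (odd d \<longrightarrow> num_valid d V E fE = 1) \<and>
            (even d \<longrightarrow> num_valid d V E fE = 2))"
proof -
  let ?S = "valid_v_labelings d V E fE"
  obtain f where f: "f \<in> ?S"
    using assms(5) unfolding additive_labeling_def by blast
  obtain r where r: "r \<in> V"
    using assms(3) unfolding connected_graph_def by blast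
  have less: "f' r < d" if "f' \<in> ?S" for f'
    using that r unfolding valid_v_labelings_iff by auto
  have num: "num_valid d V E fE = card ((\<lambda>f. f r) ` ?S)"
    unfolding num_valid_def by (simp add: card_image[OF inj_on_valid_eval[OF assms(3) r]])
  have "(\<lambda>f. f r) ` ?S = {..<d}" if no_odd: "\<not> has_odd_simple_cycle E"
  proof -
    obtain s :: "'a \<Rightarrow> int" where s: "\<And>u v. adjacent E u v \<Longrightarrow> s u + s v = 0" "\<And>v. \<bar>s v\<bar> = 1"
      using ex_two_colouring[OF assms(3,2) no_odd] by blast
    have "t \<in> (\<lambda>f. f r) ` ?S" if "t < d" for t
    \<comment> \<open>The factor \<open>s r\<close> normalises the colouring to 1 at
      \<open>r\<close>, so the shift there is exactly \<open>t - f r\<close>.\<close>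
    proof (rule valid_shift_to[OF assms(1,2) f r that,
          where s = "\<lambda>v. s v * s r * (int t - int (f r))"])
      show "s r * s r * (int t - int (f r)) = int t - int (f r)"
        using s(2)[of r] by (simp add: abs_if split: if_splits)
      show "int d dvd s u * s r * (int t - int (f r)) + s v * s r * (int t - int (f r))"
        if "adjacent E u v" for u v
        using s(1)[OF that] by (simp flip: distrib_right)
    qed
    then show ?thesis
      using less by auto
  qed
  moreover have "(\<lambda>f. f r) ` ?S = {t. t < d \<and> int d dvd 2 * (int t - int (f r))}"
    if odd_cycle: "has_odd_simple_cycle E"
  proof -
    obtain p where p: "simple_cycle E p" "odd (length p)"
      using odd_cycle unfolding has_odd_simple_cycle_def by blast
    \<comment> \<open>\<open>simple_cycle\<close> does not mention \<open>V\<close>; an edge of the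
      cycle places \<open>hd p\<close> in it.\<close>
    have "adjacent E (p ! 0) (p ! (Suc 0 mod length p))"
      using p(1) unfolding simple_cycle_def by blast
    then have "hd p \<in> V"
      using finite_graph_adjacentD[OF assms(2)] p(1)
      unfolding simple_cycle_def by (simp add: hd_conv_nth)
    then have walk: "(adjacent E)\<^sup>*\<^sup>* (hd p) r"
      using assms(3) r unfolding connected_graph_def by blast
    \<comment> \<open>The torsion condition holds at \<open>hd p\<close> on the cycle and is carried
      along \<open>walk\<close> to \<open>r\<close>.\<close>
    have "int d dvd 2 * (int (f' r) - int (f r))" if f': "f' \<in> ?S" for f'
      by (rule dvd_alternating_propagate[OF walk valid_diff_dvd[OF f' f]])
        (use dvd_alternating_odd_cycle[OF valid_diff_dvd[OF f' f] p] in auto)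
    moreover have "t \<in> (\<lambda>f. f r) ` ?S" if "t < d" "int d dvd 2 * (int t - int (f r))" for t
    proof (rule valid_shift_to[OF assms(1,2) f r that(1), where s = "\<lambda>_. int t - int (f r)"])
      show "int d dvd (int t - int (f r)) + (int t - int (f r))"
        using that(2) by (simp only: mult_2)
    qed simp
    ultimately show ?thesis
      using less by auto
  qed
  ultimately show ?thesis
    using num card_double_cong[OF less[OF f]] by auto
qed

end
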